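(* Consider the smooth problem $\min_{x\in\mathbb{R}^n} f(x)$, where $f$ is bounded below with nonempty set of minimizers $X^*$ and minimum value $f^*$, and where $f$ satisfies the Lipschitz conditions with constants $L_f,L_r,L_c$ given in the context. Assume there is a constant $\sigma>1$ with $M_\sigma=\mathbb{E}[\sigma^{\mathbf{j}}]<\infty$. Let $\{x^k\}_{k\ge1}$ be generated by the async-parallel block coordinate update with consistent delayed reading described in the context. For a certain $1<\rho<\sigma$, let $M_\rho=\mathbb{E}[\rho^{\mathbf{j}}]$, $N_\rho=\mathbb{E}[\mathbf{j}\rho^{\mathbf{j}}]$, $T=\mathbb{E}[\mathbf{j}]$, $\kappa=L_r/L_c$, and take the stepsize $\eta$ satisfying both $$0<\eta\le\frac{(\rho-1)\sqrt{m}}{\rho L_r(1+M_\rho)}\qquad\text{and}\qquad 0<\eta<2\Big(L_c\Big(M_\rho+\frac{\kappa(2N_\rho M_\rho+T)}{\sqrt{m}}\Big)\Big)^{-1}.$$ Let $$D=\frac{\eta}{2m}\Big(2-\frac{\eta L_r}{\sqrt{m}}(2N_\rho M_\rho+T)-\eta L_cM_\rho\Big).$$ Then, for all $k\ge 0$: 1. If $f$ is convex and $\|x^k-\mathcal{P}_{X^*}(x^k)\|\le B$ for all $k$, for a certain constant $B$, then $$\mathbb{E}[f(x^{k+1})-f^*]\le\frac{1}{(f(x^0)-f^* )^{-1}+(k+1)DB^{-2}}.$$ 2. If $f$ is strongly convex with constant $\mu$, then $$\mathbb{E}[f(x^{k+1})-f^*]\le(1-2\mu D)\,\mathbb{E}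[f(x^k)-f^*].$$
   Context: The variable $x=(x_1,\dots,x_m)\in\mathbb{R}^n$ is partitioned into $m$ disjoint blocks; $\nabla_i f$ is the partial gradient with respect to block $i$; $U_i y$ is the vector in $\mathbb{R}^n$ whose $i$-th block is $y_i$ and whose other blocks are zero; $\|\cdot\|$ is the Euclidean norm; $\mathcal{P}_{X^*}$ is the Euclidean projection onto $X^*$. Lipschitz conditions: for all $x,y$ and all $i\in\{1,\dots,m\}$, $\|\nabla f(x)-\nabla f(y)\|\le L_f\|x-y\|$, $\|\nabla f(x)-\nabla f(x+U_iy)\|\le L_r\|y_i\|$, $\|\nabla_i f(x)-\nabla_i f(x+U_iy)\|\le L_c\|y_i\|$. Algorithm (smooth case): given a point $x^0\in\mathbb{R}^n$ and stepsize $\eta>0$, for $k=0,1,2,\dots$ a block index $i_k$ is drawn uniformly at random from $\{1,\dots,m\}$ and $$x^{k+1}=x^k-\eta\,U_{i_k}\nabla f(x^{k-j_k}),$$ with the convention $x^k=x^0$ for $k<0$. Each delay $j_k$ is distributed as a fixed random variable $\mathbf{j}$ with $\mathrm{Prob}(\mathbf{j}=t)=q_t$, $t=0,1,2,\dots$ (possibly unbounded). The pair $(i_k,j_k)$ has independent components and is independent of the history $(i_0,j_0),\dots,(i_{k-1},j_{k-1})$. *)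

theory Defs
  imports "HOL-Probability.Probability"
begin

text \<open>
  A partition of the coordinates \<open>'n\<close> into blocks \<open>1, \<dots>, m\<close> is given by a map
  \<open>b :: 'n \<Rightarrow> nat\<close> with range \<open>{1..m}\<close>, where \<open>b l\<close> is the block containing coordinate \<open>l\<close>.
  The \<open>i\<close>-th block \<open>y\<^sub>i\<close> of \<open>y\<close> is represented by its zero extension \<open>block_embed b i y\<close>, so
  that the Euclidean norm of \<open>y\<^sub>i\<close> is \<open>norm (block_embed b i y)\<close>, and the partial gradient with
  respect to block \<open>i\<close> is \<open>block_embed b i\<close> applied to the full gradient.
\<close>

definition block_embed :: "('n::finite \<Rightarrow> nat) \<Rightarrow> nat \<Rightarrow> real ^ 'n \<Rightarrow> real ^ 'n" where
  "block_embed b i y = (\<chi> l. if b l = i then y $ l else 0)"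

definition minimizers :: "('a \<Rightarrow> real) \<Rightarrow> 'a set" where
  "minimizers f = {x. is_arg_min f (\<lambda>_. True) x}"

definition strongly_convex :: "real \<Rightarrow> ('a::real_inner \<Rightarrow> real) \<Rightarrow> bool" where
  "strongly_convex \<mu> f \<longleftrightarrow> \<mu> > 0 \<and>
     (\<forall>x y t. 0 \<le> t \<and> t \<le> 1 \<longrightarrow>
        f ((1 - t) *\<^sub>R x + t *\<^sub>R y) \<le>
          (1 - t) * f x + t * f y - \<mu> / 2 * t * (1 - t) * (norm (x - y))\<^sup>2)"

text \<open>
  Since \<^const>\<open>prob_space.indep_var\<close> requires both random variables to take values in the same
  type, the pair \<open>(i k, j k)\<close> and the history \<open>(i 0, j 0), \<dots>, (i (k - 1), j (k - 1))\<close> are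
  both written as families, indexed by \<open>{k}\<close> and \<open>{..<k}\<close>.
\<close>

definition (in prob_space) async_sampling ::
    "nat \<Rightarrow> nat pmf \<Rightarrow> (nat \<Rightarrow> 'a \<Rightarrow> nat) \<Rightarrow> (nat \<Rightarrow> 'a \<Rightarrow> nat) \<Rightarrow> bool" where
  "async_sampling m q i j \<longleftrightarrow>
     (\<forall>k. distr M (count_space UNIV) (i k) = measure_pmf (pmf_of_set {1..m}) \<and>
          distr M (count_space UNIV) (j k) = measure_pmf q \<and>
          indep_var (count_space UNIV) (i k) (count_space UNIV) (j k) \<and>
          indep_var
            (Pi\<^sub>M {k} (\<lambda>_. count_space UNIV)) (\<lambda>\<omega>. \<lambda>l\<in>{k}. (i l \<omega>, j l \<omega>))
            (Pi\<^sub>M {..<k} (\<lambda>_. count_space UNIV)) (\<lambda>\<omega>. \<lambda>l\<in>{..<k}. (i l \<omega>, j l \<omega>)))"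

text \<open>
  The stale iterate is indexed by truncated subtraction on \<^typ>\<open>nat\<close>: \<open>k - j k \<omega>\<close> is \<open>0\<close> once
  the delay exceeds \<open>k\<close>, which is the convention that iterates with negative index equal the
  starting point.
\<close>

definition async_iterates ::
    "('n::finite \<Rightarrow> nat) \<Rightarrow> (real ^ 'n \<Rightarrow> real ^ 'n) \<Rightarrow> real \<Rightarrow> real ^ 'n \<Rightarrow>
     (nat \<Rightarrow> 'w \<Rightarrow> nat) \<Rightarrow> (nat \<Rightarrow> 'w \<Rightarrow> nat) \<Rightarrow> 'w set \<Rightarrow> (nat \<Rightarrow> 'w \<Rightarrow> real ^ 'n) \<Rightarrow> bool" where
  "async_iterates b grad \<eta> x0 i j \<Omega> x \<longleftrightarrow>
     (\<forall>\<omega>\<in>\<Omega>. x 0 \<omega> = x0 \<and>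
       (\<forall>k. x (Suc k) \<omega> =
              x k \<omega> - \<eta> *\<^sub>R block_embed b (i k \<omega>) (grad (x (k - j k \<omega>) \<omega>))))"

end

theory Submission
  imports Defs
begin

text \<open>
  Write \<open>A k = \<E>[\<parallel>\<nabla>f(x\<^sup>k)\<parallel>\<^sup>2]\<close>. A step along a stale gradient \<open>\<nabla>f(x\<^sup>k\<^sup>-\<^sup>t)\<close> is harmless as long as
  the stale gradient is not much larger than the current one. The whole proof rests on the
  bound \<open>A k \<le> \<rho> A (k + 1)\<close> (\<open>mean_sq_grad_growth\<close>): in mean square, the gradient cannot shrink
  faster than geometrically. It gives \<open>A (k - t) \<le> \<rho>\<^sup>t A k\<close>, and averaging over the delay
  replaces every stale gradient by the current one at the price of the factor \<open>M\<^sub>\<rho>\<close>. This is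
  how exponential moments of the delay enter.

  The growth bound is proved by induction on \<open>k\<close>. The increment \<open>x\<^sup>k\<^sup>+\<^sup>1 - x\<^sup>k\<close> is one random
  block of a stale gradient, so its mean square is \<open>\<eta>\<^sup>2 / m\<close> times an average of \<open>A l\<close>
  over \<open>l \<le> k\<close>, and this is at most \<open>\<eta>\<^sup>2 M\<^sub>\<rho> A k / m\<close> by the induction hypothesis. The block
  Lipschitz condition then bounds \<open>A k - A (k + 1)\<close> by \<open>\<eta> L\<^sub>r (1 + M\<^sub>\<rho>) / sqrt m\<close> times \<open>A k\<close>, and the first stepsize condition
  says exactly that this factor is at most \<open>1 - 1 / \<rho>\<close>.

  For the objective, the descent lemma within the updated block (\<open>block_descent\<close>) leaves the inner
  product of the current and the stale gradient. Their difference is a telescoping sum of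
  increments, each controlled as before (\<open>stale_inner_lower_bound\<close>); the number of terms is the
  delay, which is where \<open>T\<close> and \<open>N\<^sub>\<rho>\<close> come from. Hence \<open>\<E>[f(x\<^sup>k\<^sup>+\<^sup>1)] \<le> \<E>[f(x\<^sup>k)] - D A k\<close>
  (\<open>expected_descent\<close>), and the second stepsize condition makes \<open>D\<close> nonnegative.

  It remains to bound \<open>A k\<close> from below by the optimality gap \<open>e k = \<E>[f(x\<^sup>k) - f\<^sup>*]\<close>. Convexity
  together with Jensen's inequality gives \<open>(e k)\<^sup>2 \<le> B\<^sup>2 A k\<close>, hence a quadratic recursion with
  solution of order \<open>1 / k\<close>; strong convexity gives the inequality
  \<open>2 \<mu> e k \<le> A k\<close>, hence a linear rate.
\<close>

section \<open>Block coordinates\<close>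

lemma block_embed_nth [simp]: "block_embed b a y $ l = (if b l = a then y $ l else 0)"
  by (simp add: block_embed_def)

lemma block_embed_scaleR: "block_embed b a (c *\<^sub>R y) = c *\<^sub>R block_embed b a y"
  by (simp add: vec_eq_iff)

lemma block_embed_minus: "block_embed b a (- y) = - block_embed b a y"
  by (simp add: vec_eq_iff)

lemma block_embed_idem [simp]: "block_embed b a (block_embed b a y) = block_embed b a y"
  by (simp add: vec_eq_iff)

lemma block_embed_outside: "a \<notin> range b \<Longrightarrow> block_embed b a y = 0"
  by (auto simp: vec_eq_iff)

lemma sum_block_embed:
  assumes "range b \<subseteq> S" "finite S"
  shows "(\<Sum>a\<in>S. block_embed b a y) = y"
proof -
  have "(\<Sum>a\<in>S. if b l = a then y $ l else 0) = y $ l" for l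
    using assms by (auto simp: sum.delta' image_subset_iff)
  then show ?thesis
    by (simp add: vec_eq_iff)
qed

lemma inner_block_embed_left: "inner (block_embed b a y) z = inner y (block_embed b a z)"
  by (auto simp: inner_vec_def intro!: sum.cong)

lemma norm_block_embed_sq: "(norm (block_embed b a y))\<^sup>2 = inner (block_embed b a y) y"
  by (metis block_embed_idem inner_block_embed_left power2_norm_eq_inner)

lemma sum_norm_block_embed_sq:
  assumes "range b \<subseteq> S" "finite S"
  shows "(\<Sum>a\<in>S. (norm (block_embed b a y))\<^sup>2) = (norm y)\<^sup>2"
  unfolding norm_block_embed_sq inner_sum_left[symmetric] sum_block_embed[OF assms]
  by (simp add: power2_norm_eq_inner)

text \<open>
  All block indices that are not in the range of \<open>b\<close> give the zero map. This makes the set of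
  possible iterates finite even though the sampled index is an arbitrary natural number.
\<close>

lemma finite_range_block_embed: "finite (range (block_embed b))"
proof -
  have "range (block_embed b) \<subseteq> insert (\<lambda>_. 0) (block_embed b ` range b)"
    by (auto simp: fun_eq_iff block_embed_outside) (metis block_embed_outside rangeI image_eqI)
  then show ?thesis
    by (rule finite_subset) (simp add: finite_imageI)
qed

section \<open>Descent and first-order bounds\<close>

lemma GDERIV_line:
  fixes f :: "'a::real_inner \<Rightarrow> real"
  assumes "\<And>z. GDERIV f z :> grad z"
  shows "((\<lambda>t. f (y + t *\<^sub>R u)) has_real_derivative inner (grad (y + t *\<^sub>R u)) u) (at t within S)"
proof -
  have "((\<lambda>t. f (y + t *\<^sub>R u)) has_derivative (\<lambda>s. inner (s *\<^sub>R u) (grad (y + t *\<^sub>R u)))) (at t within S)"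
    by (rule has_derivative_compose[of "\<lambda>t. y + t *\<^sub>R u" "\<lambda>s. s *\<^sub>R u" t S f])
       (use assms in \<open>auto simp: gderiv_def intro!: derivative_eq_intros\<close>)
  then show ?thesis
    unfolding has_field_derivative_def
    by (rule has_derivative_eq_rhs) (simp add: fun_eq_iff inner_commute mult.commute)
qed

text \<open>
  Subtracting the claimed quadratic upper model along the segment from \<open>y\<close> to \<open>y + u\<close> leaves a
  function whose derivative is nonpositive: since \<open>u\<close> lives in block \<open>a\<close>, the derivative sees only
  that block of the gradient difference, so the constant is the block constant.
\<close>

lemma block_descent:
  assumes grad: "\<And>z. GDERIV f z :> grad z"
    and Lc: "\<And>y z. norm (block_embed b a (grad y) - block_embed b a (grad (y + block_embed b a z)))
               \<le> Lc * norm (block_embed b a z)"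
    and u: "block_embed b a u = u"
  shows "f (y + u) \<le> f y + inner (grad y) u + Lc / 2 * (norm u)\<^sup>2"
proof -
  define \<phi> where "\<phi> t = f (y + t *\<^sub>R u) - t * inner (grad y) u - Lc / 2 * t\<^sup>2 * (norm u)\<^sup>2" for t
  have "\<phi> 1 \<le> \<phi> 0"
  proof (rule DERIV_nonpos_imp_nonincreasing[of 0 1 \<phi>])
    fix t :: real assume t: "0 \<le> t" "t \<le> 1"
    let ?d = "inner (grad (y + t *\<^sub>R u)) u - inner (grad y) u - Lc * t * (norm u)\<^sup>2"
    have "(\<phi> has_real_derivative ?d) (at t)"
      unfolding \<phi>_def
      by (rule derivative_eq_intros GDERIV_line grad refl)+ (auto simp: field_simps)
    moreover have "?d \<le> 0"
    proof -
      let ?w = "block_embed b a (grad (y + t *\<^sub>R u)) - block_embed b a (grad y)"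
      have "inner (grad (y + t *\<^sub>R u)) u - inner (grad y) u = inner ?w u"
        by (simp add: inner_diff_left inner_block_embed_left u)
      also have "\<dots> \<le> norm ?w * norm u"
        by (rule norm_cauchy_schwarz)
      also have "\<dots> \<le> (Lc * norm (t *\<^sub>R u)) * norm u"
        using Lc[of y "t *\<^sub>R u"] by (intro mult_right_mono) (auto simp: block_embed_scaleR u norm_minus_commute)
      also have "\<dots> = Lc * t * (norm u)\<^sup>2"
        using t by (simp add: power2_eq_square)
      finally show ?thesis by simp
    qed
    ultimately show "\<exists>d. (\<phi> has_real_derivative d) (at t) \<and> d \<le> 0" by blast
  qed simp
  then show ?thesis by (simp add: \<phi>_def)
qed

text \<open>
  The case \<open>\<mu> = 0\<close> is convexity, and \<open>\<mu> > 0\<close> is strong convexity. The gap \<open>g t\<close> in the assumed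
  inequality is nonnegative on \<open>[0, 1]\<close> and vanishes at \<open>0\<close>, so its derivative there is
  nonnegative, which is the claim.
\<close>

lemma first_order_lower_bound:
  fixes f :: "'a::real_inner \<Rightarrow> real"
  assumes grad: "\<And>z. GDERIV f z :> grad z"
    and conv: "\<And>t. 0 \<le> t \<Longrightarrow> t \<le> 1 \<Longrightarrow>
        f ((1 - t) *\<^sub>R y + t *\<^sub>R z) \<le> (1 - t) * f y + t * f z - \<mu> / 2 * t * (1 - t) * (norm (y - z))\<^sup>2"
  shows "f y + inner (grad y) (z - y) + \<mu> / 2 * (norm (y - z))\<^sup>2 \<le> f z"
proof -
  define g where "g t = (1 - t) * f y + t * f z - \<mu> / 2 * t * (1 - t) * (norm (y - z))\<^sup>2
      - f (y + t *\<^sub>R (z - y))" for t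
  let ?d = "f z - f y - \<mu> / 2 * (norm (y - z))\<^sup>2 - inner (grad y) (z - y)"
  have deriv: "(g has_real_derivative ?d) (at 0)"
    unfolding g_def
    by (rule derivative_eq_intros GDERIV_line grad refl)+ (auto simp: field_simps)
  have g_nonneg: "0 \<le> g t" if "0 \<le> t" "t \<le> 1" for t
    using conv[OF that] by (simp add: g_def algebra_simps)
  have g_0: "g 0 = 0" by (simp add: g_def)
  have "0 \<le> ?d"
  proof (rule ccontr)
    assume "\<not> 0 \<le> ?d"
    then obtain e where e: "e > 0" "\<And>h. 0 < h \<Longrightarrow> h < e \<Longrightarrow> g (0 + h) < g 0"
      using DERIV_neg_dec_right[OF deriv] by fastforce
    have "g (min (e / 2) 1) < 0"
      using e(2)[of "min (e / 2) 1"] e(1) g_0 by (simp add: min_def)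
    then show False
      using g_nonneg[of "min (e / 2) 1"] e(1) by simp
  qed
  then show ?thesis by simp
qed

text \<open>
  Over all \<open>z\<close>, the quadratic lower bound at \<open>y\<close> is smallest at \<open>z = y - grad y / \<mu>\<close>; the square
  expanded below is \<open>\<mu>\<^sup>2\<close> times the squared distance from \<open>z\<close> to that point.
\<close>

lemma polyak_lojasiewicz:
  assumes grad: "\<And>z. GDERIV f z :> grad z" and sc: "strongly_convex \<mu> f"
  shows "2 * \<mu> * (f y - f z) \<le> (norm (grad y))\<^sup>2"
proof -
  have \<mu>: "\<mu> > 0" using sc by (simp add: strongly_convex_def)
  have "f y + inner (grad y) (z - y) + \<mu> / 2 * (norm (y - z))\<^sup>2 \<le> f z"
    using sc by (intro first_order_lower_bound grad) (simp add: strongly_convex_def)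
  moreover have "0 \<le> (norm (grad y + \<mu> *\<^sub>R (z - y)))\<^sup>2" by simp
  moreover have "(norm (grad y + \<mu> *\<^sub>R (z - y)))\<^sup>2
      = (norm (grad y))\<^sup>2 + 2 * \<mu> * inner (grad y) (z - y) + \<mu>\<^sup>2 * (norm (y - z))\<^sup>2"
    using dot_norm[of "grad y" "\<mu> *\<^sub>R (z - y)"]
    by (simp add: norm_minus_commute[of y z] power_mult_distrib)
  moreover have "2 * \<mu> * (f y + inner (grad y) (z - y) + \<mu> / 2 * (norm (y - z))\<^sup>2) \<le> 2 * \<mu> * f z"
    using calculation(1) \<mu> by (intro mult_left_mono) auto
  moreover have "2 * \<mu> * (v - v') \<le> g"
    if "2 * \<mu> * (v + p + \<mu> / 2 * n) \<le> 2 * \<mu> * v'" "0 \<le> w" "w = g + 2 * \<mu> * p + \<mu>\<^sup>2 * n"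
    for v v' p n w g :: real
    using that by (simp add: algebra_simps power2_eq_square)
  ultimately show ?thesis by blast
qed

lemma convex_gap_bound:
  assumes grad: "\<And>z. GDERIV f z :> grad z" and conv: "convex_on UNIV f"
  shows "f y - f z \<le> norm (grad y) * norm (y - z)"
proof -
  have "f y + inner (grad y) (z - y) + 0 / 2 * (norm (y - z))\<^sup>2 \<le> f z"
    using conv by (intro first_order_lower_bound grad) (simp add: convex_on_def)
  moreover have "- inner (grad y) (z - y) \<le> norm (grad y) * norm (y - z)"
    by (metis inner_minus_right minus_diff_eq norm_cauchy_schwarz)
  ultimately show ?thesis by simp
qed

section \<open>Conditioning on the history\<close>

locale async_block_descent = prob_space M for M :: "'w measure" +
  fixes b :: "'n::finite \<Rightarrow> nat" and grad :: "real ^ 'n \<Rightarrow> real ^ 'n" and m :: nat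
    and q :: "nat pmf" and i j :: "nat \<Rightarrow> 'w \<Rightarrow> nat" and \<eta> :: real and x0 :: "real ^ 'n"
    and x :: "nat \<Rightarrow> 'w \<Rightarrow> real ^ 'n"
  assumes blocks: "range b = {1..m}"
    and sampling: "async_sampling m q i j"
    and iterates: "async_iterates b grad \<eta> x0 i j (space M) x"
begin

definition history :: "nat \<Rightarrow> 'w \<Rightarrow> nat \<Rightarrow> nat \<times> nat" where
  "history k \<omega> = (\<lambda>l\<in>{..<k}. (i l \<omega>, j l \<omega>))"

text \<open>
  An explicit form of measurability with respect to the sigma-algebra of the history: the history
  before step \<open>k\<close> has countably many values, so being a function of it is all that is required.
\<close>

definition determined_by_history :: "nat \<Rightarrow> ('w \<Rightarrow> 'c) \<Rightarrow> bool" where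
  "determined_by_history k W \<longleftrightarrow>
     (\<forall>\<omega>\<in>space M. \<forall>\<omega>'\<in>space M. history k \<omega> = history k \<omega>' \<longrightarrow> W \<omega> = W \<omega>')"

definition mean_sq_grad :: "nat \<Rightarrow> real" where
  "mean_sq_grad k = expectation (\<lambda>\<omega>. (norm (grad (x k \<omega>)))\<^sup>2)"

lemma m_pos: "1 \<le> m"
  using blocks by (metis UNIV_not_empty atLeastatMost_empty_iff2 image_is_empty)

lemma iterate_0: "\<omega> \<in> space M \<Longrightarrow> x 0 \<omega> = x0"
  and iterate_Suc: "\<omega> \<in> space M \<Longrightarrow>
    x (Suc k) \<omega> = x k \<omega> - \<eta> *\<^sub>R block_embed b (i k \<omega>) (grad (x (k - j k \<omega>) \<omega>))"
  using iterates by (auto simp: async_iterates_def)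

lemma history_eqD:
  assumes "history k \<omega> = history k \<omega>'" "l < k"
  shows "i l \<omega> = i l \<omega>'" "j l \<omega> = j l \<omega>'"
  using fun_cong[OF assms(1), of l] assms(2) by (auto simp: history_def)

lemma history_eq_mono:
  assumes "history k \<omega> = history k \<omega>'" "l \<le> k"
  shows "history l \<omega> = history l \<omega>'"
  using history_eqD[OF assms(1)] assms(2) by (auto simp: history_def fun_eq_iff restrict_def)

lemma iterate_determined: "l \<le> k \<Longrightarrow> determined_by_history k (x l)"
proof (induction l arbitrary: k rule: less_induct)
  case (less l)
  show ?case
    unfolding determined_by_history_def
  proof (intro ballI impI)
    fix \<omega> \<omega>' assume \<omega>: "\<omega> \<in> space M" "\<omega>' \<in> space M" and eq: "history k \<omega> = history k \<omega>'"
    show "x l \<omega> = x l \<omega>'"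
    proof (cases l)
      case 0
      then show ?thesis using \<omega> by (simp add: iterate_0)
    next
      case (Suc n)
      have "x n' \<omega> = x n' \<omega>'" if "n' \<le> n" for n'
      proof -
        have "determined_by_history k (x n')"
          using that Suc less.prems by (intro less.IH) auto
        then show ?thesis using \<omega> eq unfolding determined_by_history_def by blast
      qed
      moreover have "i n \<omega> = i n \<omega>'" "j n \<omega> = j n \<omega>'"
        using history_eqD[OF eq, of n] Suc less.prems by auto
      ultimately show ?thesis using \<omega> by (simp add: Suc iterate_Suc)
    qed
  qed
qed

text \<open>
  Delays are unbounded, but a delay beyond \<open>k\<close> acts like the delay \<open>k\<close>. Hence each iterate takes
  finitely many values, and every real function of finitely many iterates is bounded, hence integrable
  once it is measurable.
\<close>

lemma finite_iterate_values: "finite (x k ` space M)"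
proof (induction k rule: less_induct)
  case (less k)
  show ?case
  proof (cases k)
    case 0
    have "x k ` space M \<subseteq> {x0}" using 0 by (auto simp: iterate_0)
    then show ?thesis by (rule finite_subset) simp
  next
    case (Suc n)
    let ?Z = "\<Union>l\<in>{..n}. x l ` space M"
    have fin: "finite ?Z" using less Suc by auto
    have "x k ` space M \<subseteq> (\<lambda>(y, U, z). y - \<eta> *\<^sub>R U (grad z)) ` (?Z \<times> range (block_embed b) \<times> ?Z)"
    proof
      fix y assume "y \<in> x k ` space M"
      then obtain \<omega> where \<omega>: "\<omega> \<in> space M" "y = x (Suc n) \<omega>" using Suc by auto
      have "x n \<omega> \<in> ?Z" "x (n - j n \<omega>) \<omega> \<in> ?Z" using \<omega>(1) by (auto intro: diff_le_self)
      then have "(x n \<omega>, block_embed b (i n \<omega>), x (n - j n \<omega>) \<omega>) \<in> ?Z \<times> range (block_embed b) \<times> ?Z"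
        by blast
      moreover have "y = (\<lambda>(y, U, z). y - \<eta> *\<^sub>R U (grad z)) (x n \<omega>, block_embed b (i n \<omega>), x (n - j n \<omega>) \<omega>)"
        using \<omega> by (simp add: iterate_Suc)
      ultimately show "y \<in> (\<lambda>(y, U, z). y - \<eta> *\<^sub>R U (grad z)) ` (?Z \<times> range (block_embed b) \<times> ?Z)"
        by blast
    qed
    then show ?thesis
      by (rule finite_subset) (intro finite_imageI finite_cartesian_product fin finite_range_block_embed)
  qed
qed

lemma indep_now_history:
  "indep_var (Pi\<^sub>M {k} (\<lambda>_. count_space UNIV)) (\<lambda>\<omega>. \<lambda>l\<in>{k}. (i l \<omega>, j l \<omega>))
     (Pi\<^sub>M {..<k} (\<lambda>_. count_space UNIV)) (history k)"
  using sampling unfolding async_sampling_def history_def by blast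

lemma history_space_discrete:
  "finite I \<Longrightarrow> Pi\<^sub>M I (\<lambda>_. count_space (UNIV :: (nat \<times> nat) set)) = count_space (Pi\<^sub>E I (\<lambda>_. UNIV))"
  by (rule count_space_PiM_finite) auto

lemma determined_by_history_factor:
  fixes W :: "'w \<Rightarrow> real"
  assumes "determined_by_history k W"
  obtains G where "G \<in> borel_measurable (Pi\<^sub>M {..<k} (\<lambda>_. count_space UNIV))"
    "\<And>\<omega>. \<omega> \<in> space M \<Longrightarrow> W \<omega> = G (history k \<omega>)"
proof
  define G where "G h = W (SOME \<omega>. \<omega> \<in> space M \<and> history k \<omega> = h)" for h
  show "G \<in> borel_measurable (Pi\<^sub>M {..<k} (\<lambda>_. count_space UNIV))"
    by (simp add: history_space_discrete)
  show "W \<omega> = G (history k \<omega>)" if "\<omega> \<in> space M" for \<omega>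
  proof -
    let ?\<omega>' = "SOME \<omega>'. \<omega>' \<in> space M \<and> history k \<omega>' = history k \<omega>"
    have "?\<omega>' \<in> space M \<and> history k ?\<omega>' = history k \<omega>"
      by (rule someI[of _ \<omega>]) (use that in auto)
    then show ?thesis
      using assms that unfolding determined_by_history_def G_def by metis
  qed
qed

lemma integrable_determined:
  fixes W :: "'w \<Rightarrow> real"
  assumes det: "determined_by_history k W" and fin: "finite (W ` space M)"
  shows "integrable M W"
proof (rule integrable_const_bound)
  obtain G where G: "G \<in> borel_measurable (Pi\<^sub>M {..<k} (\<lambda>_. count_space UNIV))"
    "\<And>\<omega>. \<omega> \<in> space M \<Longrightarrow> W \<omega> = G (history k \<omega>)"
    using determined_by_history_factor[OF det] by blast
  have "(\<lambda>\<omega>. G (history k \<omega>)) \<in> borel_measurable M"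
    using measurable_compose[OF indep_var_rv2[OF indep_now_history] G(1)] .
  then show "W \<in> borel_measurable M"
    using G(2) by (simp cong: measurable_cong)
  show "AE \<omega> in M. norm (W \<omega>) \<le> Max (abs ` W ` space M)"
    using fin by (intro AE_I2) auto
qed

lemma determined_by_iterates:
  assumes "k \<le> n" "l \<le> n"
  shows "determined_by_history n (\<lambda>\<omega>. \<phi> (x k \<omega>) (x l \<omega>))"
  unfolding determined_by_history_def
proof (intro ballI impI)
  fix \<omega> \<omega>' assume "\<omega> \<in> space M" "\<omega>' \<in> space M" "history n \<omega> = history n \<omega>'"
  then have "x k \<omega> = x k \<omega>'" "x l \<omega> = x l \<omega>'"
    using assms[THEN iterate_determined] unfolding determined_by_history_def by blast+
  then show "\<phi> (x k \<omega>) (x l \<omega>) = \<phi> (x k \<omega>') (x l \<omega>')" by simp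
qed

lemma integrable_iterates:
  fixes \<phi> :: "real ^ 'n \<Rightarrow> real ^ 'n \<Rightarrow> real"
  shows "integrable M (\<lambda>\<omega>. \<phi> (x k \<omega>) (x l \<omega>))"
proof (rule integrable_determined)
  show "determined_by_history (max k l) (\<lambda>\<omega>. \<phi> (x k \<omega>) (x l \<omega>))"
    by (intro determined_by_iterates) auto
  have "(\<lambda>\<omega>. \<phi> (x k \<omega>) (x l \<omega>)) ` space M \<subseteq> (\<lambda>(y, z). \<phi> y z) ` (x k ` space M \<times> x l ` space M)"
    by (intro image_subsetI) (simp add: image_iff, blast)
  then show "finite ((\<lambda>\<omega>. \<phi> (x k \<omega>) (x l \<omega>)) ` space M)"
    by (rule finite_subset) (intro finite_imageI finite_cartesian_product finite_iterate_values)
qed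

lemma integrable_iterate:
  fixes \<phi> :: "real ^ 'n \<Rightarrow> real"
  shows "integrable M (\<lambda>\<omega>. \<phi> (x k \<omega>))"
  using integrable_iterates[of "\<lambda>y _. \<phi> y" k k] .

lemma integrable_delayed: "integrable (measure_pmf q) (\<lambda>t. h (k - t) :: real)"
proof (rule measure_pmf.integrable_const_bound)
  show "AE t in measure_pmf q. norm (h (k - t)) \<le> Max ((\<lambda>l. \<bar>h l\<bar>) ` {..k})"
    by (intro AE_I2) (auto intro!: Max_ge)
qed simp

text \<open>
  Only the truncated delay \<open>min t k\<close> enters, which turns the expectation over all delays into a
  finite sum that can be matched with a finite partition of the sample space.
\<close>

lemma expectation_delayed:
  fixes h :: "nat \<Rightarrow> real"
  shows "measure_pmf.expectation q (\<lambda>t. h (k - t))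
    = (\<Sum>s\<le>k. measure (measure_pmf q) {t. min t k = s} * h (k - s))"
proof -
  have "h (k - t) = (\<Sum>s\<le>k. indicator {t. min t k = s} t * h (k - s))" for t
  proof -
    have "(\<Sum>s\<le>k. indicator {t. min t k = s} t * h (k - s)) =
        (\<Sum>s\<le>k. if min t k = s then h (k - s) else 0)"
      by (intro sum.cong) auto
    then show ?thesis by (simp add: min_def)
  qed
  then have "measure_pmf.expectation q (\<lambda>t. h (k - t)) =
      measure_pmf.expectation q (\<lambda>t. \<Sum>s\<le>k. indicator {t. min t k = s} t * h (k - s))"
    by (rule arg_cong[OF ext])
  also have "\<dots> = (\<Sum>s\<le>k. measure (measure_pmf q) {t. min t k = s} * h (k - s))"
    by (subst Bochner_Integration.integral_sum) (auto intro!: integrable_mult_left measure_pmf.integrable_const_bound[where B = 1])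
  finally show ?thesis .
qed

lemma prob_block_delay:
  assumes "a \<in> {1..m}"
  shows "prob {\<omega> \<in> space M. i k \<omega> = a \<and> min (j k \<omega>) k = s}
    = measure (measure_pmf q) {t. min t k = s} / m"
proof -
  have ind: "indep_var (count_space UNIV) (i k) (count_space UNIV) (j k)"
    and di: "distr M (count_space UNIV) (i k) = measure_pmf (pmf_of_set {1..m})"
    and dj: "distr M (count_space UNIV) (j k) = measure_pmf q"
    using sampling by (auto simp: async_sampling_def)
  have [measurable]: "i k \<in> measurable M (count_space UNIV)" "j k \<in> measurable M (count_space UNIV)"
    using indep_var_rv1[OF ind] indep_var_rv2[OF ind] .
  have "prob {\<omega> \<in> space M. i k \<omega> = a \<and> min (j k \<omega>) k = s}
      = prob ((\<lambda>\<omega>. (i k \<omega>, j k \<omega>)) -` ({a} \<times> {t. min t k = s}) \<inter> space M)"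
    by (rule arg_cong[of _ _ prob]) auto
  also have "\<dots> = prob (i k -` {a} \<inter> space M) * prob (j k -` {t. min t k = s} \<inter> space M)"
    by (rule indep_varD[OF ind]) auto
  also have "prob (i k -` {a} \<inter> space M) = measure (distr M (count_space UNIV) (i k)) {a}"
    by (rule measure_distr[symmetric]) auto
  also have "\<dots> = 1 / m"
    using assms by (simp add: di measure_pmf_single)
  also have "prob (j k -` {t. min t k = s} \<inter> space M) = measure (distr M (count_space UNIV) (j k)) {t. min t k = s}"
    by (rule measure_distr[symmetric]) auto
  finally show ?thesis by (simp add: dj)
qed

lemma AE_block: "AE \<omega> in M. i k \<omega> \<in> {1..m}"
proof -
  have ind: "indep_var (count_space UNIV) (i k) (count_space UNIV) (j k)"
    and di: "distr M (count_space UNIV) (i k) = measure_pmf (pmf_of_set {1..m})"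
    using sampling by (auto simp: async_sampling_def)
  have "AE a in distr M (count_space UNIV) (i k). a \<in> {1..m}"
    unfolding di using m_pos by (intro AE_pmfI) (simp add: set_pmf_of_set)
  then show ?thesis
    by (rule AE_distrD[OF indep_var_rv1[OF ind]])
qed

text \<open>
  The conditional expectation given the history, in integrated form: \<open>(i k, j k)\<close> is independent of
  the iterates up to \<open>k\<close>, so the block may be averaged uniformly and the delay according to \<open>q\<close>
  while these iterates are held fixed. The proof splits the sample space by the values of the block
  index and the truncated delay; on each piece independence factorizes the expectation.
\<close>

lemma expectation_step:
  fixes \<phi> :: "real ^ 'n \<Rightarrow> real ^ 'n \<Rightarrow> real"
  shows "expectation (\<lambda>\<omega>. \<phi> (x k \<omega>) (x (Suc k) \<omega>)) = measure_pmf.expectation q (\<lambda>t.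
    (\<Sum>a\<in>{1..m}. expectation (\<lambda>\<omega>. \<phi> (x k \<omega>) (x k \<omega> - \<eta> *\<^sub>R block_embed b a (grad (x (k - t) \<omega>))))) / m)"
proof -
  define H where "H a l = (\<lambda>\<omega>. \<phi> (x k \<omega>) (x k \<omega> - \<eta> *\<^sub>R block_embed b a (grad (x l \<omega>))))" for a l
  define P :: "nat \<Rightarrow> nat \<Rightarrow> 'w \<Rightarrow> real"
    where "P a s \<omega> = of_bool (i k \<omega> = a \<and> min (j k \<omega>) k = s)" for a s \<omega>
  let ?now = "\<lambda>\<omega>. \<lambda>l\<in>{k}. (i l \<omega>, j l \<omega>)"
  have P: "integrable M (P a s)"
    and PH_int: "integrable M (\<lambda>\<omega>. P a s \<omega> * H a (k - s) \<omega>)"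
    and PH: "expectation (\<lambda>\<omega>. P a s \<omega> * H a (k - s) \<omega>) = expectation (P a s) * expectation (H a (k - s))" for a s
  proof -
    let ?Y = "\<lambda>p. of_bool (fst (p k) = a \<and> min (snd (p k)) k = s) :: real"
    have Y: "?Y \<in> borel_measurable (Pi\<^sub>M {k} (\<lambda>_. count_space UNIV))"
      by (simp add: history_space_discrete)
    have PY: "P a s = ?Y \<circ> ?now" by (auto simp: P_def)
    have "P a s \<in> borel_measurable M"
      unfolding PY comp_def using measurable_compose[OF indep_var_rv1[OF indep_now_history] Y] .
    then show Pint: "integrable M (P a s)"
      by (rule integrable_const_bound[rotated, where B = 1]) (auto simp: P_def)
    have "determined_by_history k (H a (k - s))"
      unfolding H_def
      by (rule determined_by_iterates[of _ _ _ "\<lambda>y z. \<phi> y (y - \<eta> *\<^sub>R block_embed b a (grad z))"]) auto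
    then obtain G where G: "G \<in> borel_measurable (Pi\<^sub>M {..<k} (\<lambda>_. count_space UNIV))"
      "\<And>\<omega>. \<omega> \<in> space M \<Longrightarrow> H a (k - s) \<omega> = (G \<circ> history k) \<omega>"
      using determined_by_history_factor[of k] by (auto simp: comp_def)
    have Hint: "integrable M (H a (k - s))"
      unfolding H_def by (rule integrable_iterates[of "\<lambda>y z. \<phi> y (y - \<eta> *\<^sub>R block_embed b a (grad z))"])
    have Gint: "integrable M (G \<circ> history k)"
      using Hint G(2) by (simp cong: Bochner_Integration.integrable_cong)
    have ind: "indep_var borel (P a s) borel (G \<circ> history k)"
      unfolding PY by (rule indep_var_compose[OF indep_now_history Y G(1)])
    have "integrable M (\<lambda>\<omega>. P a s \<omega> * (G \<circ> history k) \<omega>)"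
      by (rule indep_var_integrable[OF ind Pint Gint])
    then show "integrable M (\<lambda>\<omega>. P a s \<omega> * H a (k - s) \<omega>)"
      using G(2) by (simp cong: Bochner_Integration.integrable_cong)
    show "expectation (\<lambda>\<omega>. P a s \<omega> * H a (k - s) \<omega>) = expectation (P a s) * expectation (H a (k - s))"
      using indep_var_lebesgue_integral[OF ind Pint Gint] G(2)
      by (simp cong: Bochner_Integration.integral_cong)
  qed
  have EP: "expectation (P a s) = measure (measure_pmf q) {t. min t k = s} / m" if "a \<in> {1..m}" for a s
  proof -
    have "expectation (P a s) = expectation (indicator {\<omega> \<in> space M. i k \<omega> = a \<and> min (j k \<omega>) k = s})"
      by (intro Bochner_Integration.integral_cong) (auto simp: P_def)
    also have "\<dots> = prob {\<omega> \<in> space M. i k \<omega> = a \<and> min (j k \<omega>) k = s}"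
      by (simp add: Int_def conj_commute cong: conj_cong)
    finally show ?thesis by (simp add: prob_block_delay[OF that])
  qed
  have "AE \<omega> in M. \<phi> (x k \<omega>) (x (Suc k) \<omega>) = (\<Sum>a\<in>{1..m}. \<Sum>s\<le>k. P a s \<omega> * H a (k - s) \<omega>)"
    using AE_block[of k] AE_space
  proof eventually_elim
    case (elim \<omega>)
    have "(\<Sum>s\<le>k. P a s \<omega> * H a (k - s) \<omega>) = (if i k \<omega> = a then H a (k - j k \<omega>) \<omega> else 0)" for a
    proof -
      have "(\<Sum>s\<le>k. P a s \<omega> * H a (k - s) \<omega>)
          = (\<Sum>s\<le>k. if min (j k \<omega>) k = s then (if i k \<omega> = a then H a (k - s) \<omega> else 0) else 0)"
        by (intro sum.cong) (auto simp: P_def)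
      then show ?thesis by (simp add: min_def)
    qed
    then show ?case
      using elim by (simp add: H_def iterate_Suc)
  qed
  then have "expectation (\<lambda>\<omega>. \<phi> (x k \<omega>) (x (Suc k) \<omega>)) =
      expectation (\<lambda>\<omega>. \<Sum>a\<in>{1..m}. \<Sum>s\<le>k. P a s \<omega> * H a (k - s) \<omega>)"
    by (intro integral_cong_AE borel_measurable_integrable integrable_iterates
        Bochner_Integration.integrable_sum PH_int)
  also have "\<dots> = (\<Sum>a\<in>{1..m}. \<Sum>s\<le>k. expectation (\<lambda>\<omega>. P a s \<omega> * H a (k - s) \<omega>))"
    by (simp add: Bochner_Integration.integral_sum Bochner_Integration.integrable_sum PH_int)
  also have "\<dots> = (\<Sum>a\<in>{1..m}. \<Sum>s\<le>k. measure (measure_pmf q) {t. min t k = s} * (expectation (H a (k - s)) / m))"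
    by (simp add: PH EP)
  also have "\<dots> = (\<Sum>s\<le>k. measure (measure_pmf q) {t. min t k = s} * ((\<Sum>a\<in>{1..m}. expectation (H a (k - s))) / m))"
    by (subst sum.swap) (simp add: sum_distrib_left sum_divide_distrib)
  also have "\<dots> = measure_pmf.expectation q (\<lambda>t. (\<Sum>a\<in>{1..m}. expectation (H a (k - t))) / m)"
    by (rule expectation_delayed[symmetric, where h = "\<lambda>l. (\<Sum>a\<in>{1..m}. expectation (H a l)) / m"])
  finally show ?thesis by (simp add: H_def)
qed

text \<open>
  Averaging over the blocks sums the squared norms of the blocks of one stale gradient to its full
  squared norm, with a gain of \<open>1 / m\<close>. Likewise, in the next lemma, the average block of a stale
  gradient is \<open>1 / m\<close> times the gradient itself.
\<close>

lemma expectation_step_sq: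
  "expectation (\<lambda>\<omega>. (norm (x (Suc k) \<omega> - x k \<omega>))\<^sup>2)
    = \<eta>\<^sup>2 / m * measure_pmf.expectation q (\<lambda>t. mean_sq_grad (k - t))"
proof -
  have *: "(\<Sum>a\<in>{1..m}. expectation (\<lambda>\<omega>. (norm (x k \<omega> - \<eta> *\<^sub>R block_embed b a (grad (x l \<omega>)) - x k \<omega>))\<^sup>2)) / m
      = \<eta>\<^sup>2 / m * mean_sq_grad l" for l
  proof -
    have "(\<Sum>a\<in>{1..m}. expectation (\<lambda>\<omega>. (norm (x k \<omega> - \<eta> *\<^sub>R block_embed b a (grad (x l \<omega>)) - x k \<omega>))\<^sup>2))
      = expectation (\<lambda>\<omega>. \<Sum>a\<in>{1..m}. \<eta>\<^sup>2 * (norm (block_embed b a (grad (x l \<omega>))))\<^sup>2)"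
      by (subst Bochner_Integration.integral_sum)
         (auto intro!: integrable_iterate[of "\<lambda>y. (norm (block_embed b _ (grad y)))\<^sup>2"] simp: power_mult_distrib)
    also have "\<dots> = \<eta>\<^sup>2 * mean_sq_grad l"
      by (simp add: sum_norm_block_embed_sq blocks mean_sq_grad_def flip: sum_distrib_left)
    finally show ?thesis by simp
  qed
  show ?thesis
    by (subst expectation_step[of "\<lambda>y z. (norm (z - y))\<^sup>2"]) (simp only: * integral_mult_right_zero)
qed

lemma expectation_step_inner:
  "expectation (\<lambda>\<omega>. inner (grad (x k \<omega>)) (x (Suc k) \<omega> - x k \<omega>))
    = - (\<eta> / m) * measure_pmf.expectation q (\<lambda>t. expectation (\<lambda>\<omega>. inner (grad (x k \<omega>)) (grad (x (k - t) \<omega>))))"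
proof -
  have "(\<Sum>a\<in>{1..m}. expectation (\<lambda>\<omega>. inner (grad (x k \<omega>)) (x k \<omega> - \<eta> *\<^sub>R block_embed b a (grad (x l \<omega>)) - x k \<omega>))) / m
      = - (\<eta> / m) * expectation (\<lambda>\<omega>. inner (grad (x k \<omega>)) (grad (x l \<omega>)))" for l
  proof -
    have "(\<Sum>a\<in>{1..m}. expectation (\<lambda>\<omega>. inner (grad (x k \<omega>)) (x k \<omega> - \<eta> *\<^sub>R block_embed b a (grad (x l \<omega>)) - x k \<omega>)))
      = expectation (\<lambda>\<omega>. \<Sum>a\<in>{1..m}. - \<eta> * inner (grad (x k \<omega>)) (block_embed b a (grad (x l \<omega>))))"
      by (subst Bochner_Integration.integral_sum)
         (auto intro!: integrable_iterates[of "\<lambda>y z. inner (grad y) (block_embed b _ (grad z))"])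
    also have "\<dots> = - \<eta> * expectation (\<lambda>\<omega>. inner (grad (x k \<omega>)) (grad (x l \<omega>)))"
      unfolding sum_distrib_left[symmetric] inner_sum_right[symmetric]
      using blocks by (simp add: sum_block_embed)
    finally show ?thesis by simp
  qed
  then show ?thesis
    by (subst expectation_step[of "\<lambda>y z. inner (grad y) (z - y)"]) simp
qed

end

section \<open>Gradient growth and expected descent\<close>

text \<open>
  It is used with \<open>a\<close> a gradient norm, \<open>w\<close> the length of an increment and \<open>c = \<eta> / sqrt m\<close>. In
  mean square an increment is about \<open>\<eta> / sqrt m\<close> times a gradient, so this weight balances the two
  terms and is the source of \<open>sqrt m\<close> in the stepsize conditions.
\<close>

lemma young_weighted:
  fixes a w c :: real
  assumes "0 < c"
  shows "a * w \<le> (c * a\<^sup>2 + w\<^sup>2 / c) / 2"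
proof -
  have "0 \<le> (c * a - w)\<^sup>2 / c" using assms by simp
  also have "\<dots> = c * a\<^sup>2 + w\<^sup>2 / c - 2 * (a * w)"
    using assms by (simp add: field_simps power2_eq_square)
  finally show ?thesis by simp
qed

lemma norm_sq_diff_le: "(norm u)\<^sup>2 - (norm v)\<^sup>2 \<le> 2 * (norm u * norm (v - u))"
  for u v :: "'a::real_inner"
proof -
  have "(norm v)\<^sup>2 = (norm u)\<^sup>2 + 2 * inner u (v - u) + (norm (v - u))\<^sup>2"
    using dot_norm[of u "v - u"] by simp
  moreover have "- inner u (v - u) \<le> norm u * norm (v - u)"
    by (metis inner_minus_right norm_cauchy_schwarz norm_minus_cancel)
  ultimately show ?thesis by (smt (verit) zero_le_power2)
qed

locale stable_async_block_descent = async_block_descent +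
  fixes Lr \<rho> M\<^sub>\<rho> :: real
  assumes Lr: "\<And>y z l. l \<in> {1..m} \<Longrightarrow>
      norm (grad y - grad (y + block_embed b l z)) \<le> Lr * norm (block_embed b l z)"
    and Lr_pos: "0 < Lr"
    and rho_gt_1: "1 < \<rho>"
    and rho_integrable: "integrable (measure_pmf q) (\<lambda>t. \<rho> ^ t)"
    and M_rho: "M\<^sub>\<rho> = measure_pmf.expectation q (\<lambda>t. \<rho> ^ t)"
    and eta_pos: "0 < \<eta>"
    and eta_bound: "\<eta> \<le> (\<rho> - 1) * sqrt (real m) / (\<rho> * Lr * (1 + M\<^sub>\<rho>))"
begin

lemma M_rho_nonneg: "0 \<le> M\<^sub>\<rho>"
  unfolding M_rho using rho_gt_1 by (intro integral_nonneg_AE) simp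

lemma mean_sq_grad_nonneg: "0 \<le> mean_sq_grad k"
  unfolding mean_sq_grad_def by simp

lemma sqrt_m_pos: "0 < sqrt (real m)"
  using m_pos by simp

text \<open>
  Block indices outside \<open>{1..m}\<close> occur with probability zero, but they are not impossible. They
  select no coordinate, so the iterate stands still and the estimates below hold at every sample
  point.
\<close>

lemma increment_outside: "\<omega> \<in> space M \<Longrightarrow> i l \<omega> \<notin> {1..m} \<Longrightarrow> x (Suc l) \<omega> = x l \<omega>"
  using blocks by (simp add: iterate_Suc block_embed_outside)

lemma increment_in_block:
  assumes "\<omega> \<in> space M"
  shows "block_embed b (i l \<omega>) (x (Suc l) \<omega> - x l \<omega>) = x (Suc l) \<omega> - x l \<omega>"
  using assms by (simp add: iterate_Suc block_embed_minus block_embed_scaleR)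

lemma grad_increment:
  assumes \<omega>: "\<omega> \<in> space M"
  shows "norm (grad (x (Suc l) \<omega>) - grad (x l \<omega>)) \<le> Lr * norm (x (Suc l) \<omega> - x l \<omega>)"
proof (cases "i l \<omega> \<in> {1..m}")
  case True
  then show ?thesis
    using Lr[of "i l \<omega>" "x l \<omega>" "x (Suc l) \<omega> - x l \<omega>"]
    by (simp add: increment_in_block[OF \<omega>] norm_minus_commute)
qed (simp add: increment_outside \<omega>)

lemma weighted_step_sq:
  "expectation (\<lambda>\<omega>. (norm (x (Suc k) \<omega> - x k \<omega>))\<^sup>2) / (\<eta> / sqrt m)
    = \<eta> / sqrt m * measure_pmf.expectation q (\<lambda>t. mean_sq_grad (k - t))"
proof -
  have "a\<^sup>2 / (r * r) * E / (a / r) = a / r * E" if "0 < a" "0 < r" for a r E :: real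
    using that by (simp add: field_simps power2_eq_square)
  from this[OF eta_pos sqrt_m_pos] show ?thesis
    by (simp add: expectation_step_sq)
qed

text \<open>
  The growth bound is assumed only before step \<open>k\<close>, so that this lemma and the next can be used
  inside the induction that proves it.
\<close>

lemma mean_sq_grad_delayed:
  assumes "\<And>l. l < k \<Longrightarrow> mean_sq_grad l \<le> \<rho> * mean_sq_grad (Suc l)"
  shows "mean_sq_grad (k - t) \<le> \<rho> ^ t * mean_sq_grad k"
proof (induction t)
  case (Suc t)
  have "mean_sq_grad (k - Suc t) \<le> \<rho> * mean_sq_grad (k - t)"
  proof (cases "t < k")
    case True
    then show ?thesis using assms[of "k - Suc t"] by (simp add: Suc_diff_Suc)
  next
    case False
    then show ?thesis
      using mult_right_mono[of 1 \<rho> "mean_sq_grad 0"] rho_gt_1 mean_sq_grad_nonneg by simp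
  qed
  also have "\<dots> \<le> \<rho> * (\<rho> ^ t * mean_sq_grad k)"
    using Suc rho_gt_1 by (intro mult_left_mono) auto
  finally show ?case by (simp add: mult.assoc)
qed simp

lemma expectation_mean_sq_grad_delayed:
  assumes "\<And>l. l < k \<Longrightarrow> mean_sq_grad l \<le> \<rho> * mean_sq_grad (Suc l)"
  shows "measure_pmf.expectation q (\<lambda>t. mean_sq_grad (k - t)) \<le> M\<^sub>\<rho> * mean_sq_grad k"
proof -
  have "measure_pmf.expectation q (\<lambda>t. mean_sq_grad (k - t))
      \<le> measure_pmf.expectation q (\<lambda>t. \<rho> ^ t * mean_sq_grad k)"
    using mean_sq_grad_delayed[OF assms]
    by (intro integral_mono integrable_delayed integrable_mult_left rho_integrable) auto
  then show ?thesis by (simp add: M_rho)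
qed

lemma mean_sq_grad_growth: "mean_sq_grad k \<le> \<rho> * mean_sq_grad (Suc k)"
proof (induction k rule: less_induct)
  case (less k)
  define c where "c = \<eta> / sqrt m"
  have c: "0 < c" using eta_pos sqrt_m_pos by (simp add: c_def)
  let ?\<Delta> = "\<lambda>\<omega>. norm (x (Suc k) \<omega> - x k \<omega>)"
  have pointwise: "(norm (grad (x k \<omega>)))\<^sup>2 - (norm (grad (x (Suc k) \<omega>)))\<^sup>2
      \<le> Lr * (c * (norm (grad (x k \<omega>)))\<^sup>2 + (?\<Delta> \<omega>)\<^sup>2 / c)" if "\<omega> \<in> space M" for \<omega>
  proof -
    have "(norm (grad (x k \<omega>)))\<^sup>2 - (norm (grad (x (Suc k) \<omega>)))\<^sup>2
        \<le> 2 * (norm (grad (x k \<omega>)) * norm (grad (x (Suc k) \<omega>) - grad (x k \<omega>)))"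
      by (rule norm_sq_diff_le)
    also have "\<dots> \<le> 2 * (norm (grad (x k \<omega>)) * (Lr * ?\<Delta> \<omega>))"
      by (intro mult_left_mono grad_increment that) auto
    also have "\<dots> = 2 * Lr * (norm (grad (x k \<omega>)) * ?\<Delta> \<omega>)" by simp
    also have "\<dots> \<le> 2 * Lr * ((c * (norm (grad (x k \<omega>)))\<^sup>2 + (?\<Delta> \<omega>)\<^sup>2 / c) / 2)"
      using Lr_pos c by (intro mult_left_mono young_weighted) auto
    finally show ?thesis by simp
  qed
  have int_g: "integrable M (\<lambda>\<omega>. (norm (grad (x l \<omega>)))\<^sup>2)" for l
    by (rule integrable_iterate)
  have int_\<Delta>: "integrable M (\<lambda>\<omega>. (?\<Delta> \<omega>)\<^sup>2)"
    by (rule integrable_iterates[of "\<lambda>y z. (norm (y - z))\<^sup>2"])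
  have "mean_sq_grad k - mean_sq_grad (Suc k)
      = expectation (\<lambda>\<omega>. (norm (grad (x k \<omega>)))\<^sup>2 - (norm (grad (x (Suc k) \<omega>)))\<^sup>2)"
    by (simp add: mean_sq_grad_def int_g)
  also have "\<dots> \<le> expectation (\<lambda>\<omega>. Lr * (c * (norm (grad (x k \<omega>)))\<^sup>2 + (?\<Delta> \<omega>)\<^sup>2 / c))"
    by (intro integral_mono Bochner_Integration.integrable_diff Bochner_Integration.integrable_add
        integrable_mult_right integrable_divide int_g int_\<Delta> pointwise)
  also have "\<dots> = Lr * (c * mean_sq_grad k + expectation (\<lambda>\<omega>. (?\<Delta> \<omega>)\<^sup>2) / c)"
    by (simp add: mean_sq_grad_def int_g int_\<Delta>)
  also have "\<dots> \<le> Lr * (c * mean_sq_grad k + c * (M\<^sub>\<rho> * mean_sq_grad k))"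
    unfolding c_def weighted_step_sq
    using Lr_pos c less by (intro mult_left_mono add_left_mono expectation_mean_sq_grad_delayed) (auto simp: c_def)
  also have "\<dots> = Lr * c * (1 + M\<^sub>\<rho>) * mean_sq_grad k"
    by (simp add: algebra_simps)
  also have "\<dots> \<le> (1 - 1 / \<rho>) * mean_sq_grad k"
  proof (intro mult_right_mono mean_sq_grad_nonneg)
    have pos: "0 < \<rho> * Lr * (1 + M\<^sub>\<rho>)" using rho_gt_1 Lr_pos M_rho_nonneg by simp
    have "\<eta> * (\<rho> * Lr * (1 + M\<^sub>\<rho>)) \<le> (\<rho> - 1) * sqrt m"
      using eta_bound pos by (simp add: pos_le_divide_eq)
    then show "Lr * c * (1 + M\<^sub>\<rho>) \<le> 1 - 1 / \<rho>"
      using rho_gt_1 sqrt_m_pos by (simp add: c_def field_simps)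
  qed
  finally have "mean_sq_grad k / \<rho> \<le> mean_sq_grad (Suc k)" by (simp add: algebra_simps)
  then show ?case using rho_gt_1 by (simp add: field_simps)
qed

text \<open>
  The current and the stale gradient differ by the sum of the gradient increments over the delay.
  There are at most \<open>t\<close> of them, and each mean squared increment is an average of gradients that
  are stale relative to its own step \<open>l\<close>, hence at most \<open>\<eta>\<^sup>2 M\<^sub>\<rho> A l / m\<close> where \<open>A l\<close> is the mean
  squared gradient, and \<open>A l \<le> \<rho>\<^sup>t A k\<close> because \<open>l \<ge> k - t\<close>.
\<close>

lemma stale_inner_lower_bound:
  "mean_sq_grad k * (1 - \<eta> * Lr / (2 * sqrt m) * (real t + M\<^sub>\<rho> * (real t * \<rho> ^ t)))
    \<le> expectation (\<lambda>\<omega>. inner (grad (x k \<omega>)) (grad (x (k - t) \<omega>)))"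
proof -
  define c where "c = \<eta> / sqrt m"
  have c: "0 < c" using eta_pos sqrt_m_pos by (simp add: c_def)
  let ?g = "\<lambda>l \<omega>. grad (x l \<omega>)" and ?\<Delta> = "\<lambda>l \<omega>. norm (x (Suc l) \<omega> - x l \<omega>)"
  let ?bound = "\<lambda>l \<omega>. Lr / 2 * (c * (norm (?g k \<omega>))\<^sup>2 + (?\<Delta> l \<omega>)\<^sup>2 / c)"
  have pointwise: "(norm (?g k \<omega>))\<^sup>2 - (\<Sum>l\<in>{k - t..<k}. ?bound l \<omega>) \<le> inner (?g k \<omega>) (?g (k - t) \<omega>)"
    if \<omega>: "\<omega> \<in> space M" for \<omega>
  proof -
    have "(norm (?g k \<omega>))\<^sup>2 - inner (?g k \<omega>) (?g (k - t) \<omega>) = inner (?g k \<omega>) (?g k \<omega> - ?g (k - t) \<omega>)"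
      by (simp add: inner_diff_right power2_norm_eq_inner)
    also have "\<dots> = inner (?g k \<omega>) (\<Sum>l\<in>{k - t..<k}. ?g (Suc l) \<omega> - ?g l \<omega>)"
      by (simp add: sum_Suc_diff'[of "k - t" k "\<lambda>l. ?g l \<omega>"])
    also have "\<dots> = (\<Sum>l\<in>{k - t..<k}. inner (?g k \<omega>) (?g (Suc l) \<omega> - ?g l \<omega>))"
      by (rule inner_sum_right)
    also have "\<dots> \<le> (\<Sum>l\<in>{k - t..<k}. ?bound l \<omega>)"
    proof (rule sum_mono)
      fix l
      have "inner (?g k \<omega>) (?g (Suc l) \<omega> - ?g l \<omega>) \<le> norm (?g k \<omega>) * norm (?g (Suc l) \<omega> - ?g l \<omega>)"
        by (rule norm_cauchy_schwarz)
      also have "\<dots> \<le> norm (?g k \<omega>) * (Lr * ?\<Delta> l \<omega>)"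
        by (intro mult_left_mono grad_increment \<omega>) auto
      also have "\<dots> = Lr * (norm (?g k \<omega>) * ?\<Delta> l \<omega>)" by simp
      also have "\<dots> \<le> Lr * ((c * (norm (?g k \<omega>))\<^sup>2 + (?\<Delta> l \<omega>)\<^sup>2 / c) / 2)"
        using Lr_pos c by (intro mult_left_mono young_weighted) auto
      finally show "inner (?g k \<omega>) (?g (Suc l) \<omega> - ?g l \<omega>) \<le> ?bound l \<omega>" by simp
    qed
    finally show ?thesis by simp
  qed
  have int_g: "integrable M (\<lambda>\<omega>. (norm (?g k \<omega>))\<^sup>2)"
    by (rule integrable_iterate)
  have int_\<Delta>: "integrable M (\<lambda>\<omega>. (?\<Delta> l \<omega>)\<^sup>2)" for l
    by (rule integrable_iterates[of "\<lambda>y z. (norm (y - z))\<^sup>2"])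
  have int_bound: "integrable M (?bound l)" for l
    by (intro Bochner_Integration.integrable_add integrable_mult_right integrable_divide int_g int_\<Delta>)
  have bound: "expectation (?bound l) \<le> Lr / 2 * c * (1 + M\<^sub>\<rho> * \<rho> ^ t) * mean_sq_grad k"
    if l: "l \<in> {k - t..<k}" for l
  proof -
    have "expectation (?bound l) = Lr / 2 * (c * mean_sq_grad k + expectation (\<lambda>\<omega>. (?\<Delta> l \<omega>)\<^sup>2) / c)"
      by (simp add: mean_sq_grad_def int_g int_\<Delta>)
    also have "\<dots> \<le> Lr / 2 * (c * mean_sq_grad k + c * (M\<^sub>\<rho> * (\<rho> ^ t * mean_sq_grad k)))"
    proof -
      have "measure_pmf.expectation q (\<lambda>t. mean_sq_grad (l - t)) \<le> M\<^sub>\<rho> * mean_sq_grad l"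
        by (intro expectation_mean_sq_grad_delayed mean_sq_grad_growth)
      also have "\<dots> \<le> M\<^sub>\<rho> * (\<rho> ^ t * mean_sq_grad k)"
      proof (intro mult_left_mono M_rho_nonneg)
        have "mean_sq_grad l \<le> \<rho> ^ (k - l) * mean_sq_grad k"
          using mean_sq_grad_delayed[OF mean_sq_grad_growth, of k "k - l"] l by simp
        also have "\<dots> \<le> \<rho> ^ t * mean_sq_grad k"
          using l rho_gt_1 by (intro mult_right_mono power_increasing mean_sq_grad_nonneg) auto
        finally show "mean_sq_grad l \<le> \<rho> ^ t * mean_sq_grad k" .
      qed
      finally show ?thesis
        unfolding c_def weighted_step_sq
        using Lr_pos c by (intro mult_left_mono add_left_mono) (auto simp: c_def)
    qed
    finally show ?thesis by (simp add: algebra_simps)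
  qed
  have "(\<Sum>l\<in>{k - t..<k}. expectation (?bound l))
      \<le> (\<Sum>l\<in>{k - t..<k}. Lr / 2 * c * (1 + M\<^sub>\<rho> * \<rho> ^ t) * mean_sq_grad k)"
    by (rule sum_mono) (rule bound)
  also have "\<dots> = real (k - (k - t)) * (Lr / 2 * c * (1 + M\<^sub>\<rho> * \<rho> ^ t) * mean_sq_grad k)"
    by simp
  also have "\<dots> \<le> real t * (Lr / 2 * c * (1 + M\<^sub>\<rho> * \<rho> ^ t) * mean_sq_grad k)"
    using Lr_pos c M_rho_nonneg mean_sq_grad_nonneg rho_gt_1
    by (intro mult_right_mono mult_nonneg_nonneg add_nonneg_nonneg) auto
  finally have drift: "(\<Sum>l\<in>{k - t..<k}. expectation (?bound l))
      \<le> real t * (Lr / 2 * c * (1 + M\<^sub>\<rho> * \<rho> ^ t) * mean_sq_grad k)" .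
  have "mean_sq_grad k * (1 - \<eta> * Lr / (2 * sqrt m) * (real t + M\<^sub>\<rho> * (real t * \<rho> ^ t)))
      = mean_sq_grad k - real t * (Lr / 2 * c * (1 + M\<^sub>\<rho> * \<rho> ^ t) * mean_sq_grad k)"
    using sqrt_m_pos by (simp add: c_def field_simps)
  also have "\<dots> \<le> mean_sq_grad k - (\<Sum>l\<in>{k - t..<k}. expectation (?bound l))"
    using drift by simp
  also have "\<dots> = expectation (\<lambda>\<omega>. (norm (?g k \<omega>))\<^sup>2 - (\<Sum>l\<in>{k - t..<k}. ?bound l \<omega>))"
    unfolding mean_sq_grad_def
    by (simp only: Bochner_Integration.integral_sum[OF int_bound]
        Bochner_Integration.integral_diff[OF int_g Bochner_Integration.integrable_sum[OF int_bound]])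
  also have "\<dots> \<le> expectation (\<lambda>\<omega>. inner (?g k \<omega>) (?g (k - t) \<omega>))"
    by (intro integral_mono Bochner_Integration.integrable_diff Bochner_Integration.integrable_sum
        int_g int_bound pointwise integrable_iterates[of "\<lambda>y z. inner (grad y) (grad z)"])
  finally show ?thesis .
qed

lemma expected_descent:
  assumes gradient: "\<And>y. GDERIV f y :> grad y"
    and Lc: "\<And>y z l. l \<in> {1..m} \<Longrightarrow>
               norm (block_embed b l (grad y) - block_embed b l (grad (y + block_embed b l z)))
                 \<le> Lc * norm (block_embed b l z)"
    and Lc_nonneg: "0 \<le> Lc"
    and int_t: "integrable (measure_pmf q) (\<lambda>t. real t)"
    and int_N: "integrable (measure_pmf q) (\<lambda>t. real t * \<rho> ^ t)"
    and T: "T = measure_pmf.expectation q (\<lambda>t. real t)"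
    and N: "N\<^sub>\<rho> = measure_pmf.expectation q (\<lambda>t. real t * \<rho> ^ t)"
  shows "expectation (\<lambda>\<omega>. f (x (Suc k) \<omega>)) \<le> expectation (\<lambda>\<omega>. f (x k \<omega>))
    - \<eta> / (2 * real m) * (2 - \<eta> * Lr / sqrt (real m) * (N\<^sub>\<rho> * M\<^sub>\<rho> + T) - \<eta> * Lc * M\<^sub>\<rho>) * mean_sq_grad k"
proof -
  let ?\<Delta> = "\<lambda>\<omega>. x (Suc k) \<omega> - x k \<omega>"
  have pointwise: "f (x (Suc k) \<omega>) \<le> f (x k \<omega>) + inner (grad (x k \<omega>)) (?\<Delta> \<omega>) + Lc / 2 * (norm (?\<Delta> \<omega>))\<^sup>2"
    if \<omega>: "\<omega> \<in> space M" for \<omega>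
  proof (cases "i k \<omega> \<in> {1..m}")
    case True
    then show ?thesis
      using block_descent[OF gradient Lc[OF True] increment_in_block[OF \<omega>], of "x k \<omega>"] by simp
  qed (simp add: increment_outside \<omega>)
  have int_f: "integrable M (\<lambda>\<omega>. f (x l \<omega>))" for l
    by (rule integrable_iterate)
  have int_inner: "integrable M (\<lambda>\<omega>. inner (grad (x k \<omega>)) (?\<Delta> \<omega>))"
    by (rule integrable_iterates[of "\<lambda>y z. inner (grad y) (z - y)"])
  have int_sq: "integrable M (\<lambda>\<omega>. (norm (?\<Delta> \<omega>))\<^sup>2)"
    by (rule integrable_iterates[of "\<lambda>y z. (norm (y - z))\<^sup>2"])
  have "expectation (\<lambda>\<omega>. f (x (Suc k) \<omega>))
      \<le> expectation (\<lambda>\<omega>. f (x k \<omega>) + inner (grad (x k \<omega>)) (?\<Delta> \<omega>) + Lc / 2 * (norm (?\<Delta> \<omega>))\<^sup>2)"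
    by (intro integral_mono Bochner_Integration.integrable_add integrable_mult_right int_f int_inner
        int_sq pointwise)
  also have "\<dots> = expectation (\<lambda>\<omega>. f (x k \<omega>)) + expectation (\<lambda>\<omega>. inner (grad (x k \<omega>)) (?\<Delta> \<omega>))
      + Lc / 2 * expectation (\<lambda>\<omega>. (norm (?\<Delta> \<omega>))\<^sup>2)"
    by (simp add: int_f int_inner int_sq)
  finally have descent: "expectation (\<lambda>\<omega>. f (x (Suc k) \<omega>))
      \<le> expectation (\<lambda>\<omega>. f (x k \<omega>)) + expectation (\<lambda>\<omega>. inner (grad (x k \<omega>)) (?\<Delta> \<omega>))
      + Lc / 2 * expectation (\<lambda>\<omega>. (norm (?\<Delta> \<omega>))\<^sup>2)" .
  have "Lc / 2 * expectation (\<lambda>\<omega>. (norm (?\<Delta> \<omega>))\<^sup>2) \<le> Lc / 2 * (\<eta>\<^sup>2 / m * (M\<^sub>\<rho> * mean_sq_grad k))"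
    unfolding expectation_step_sq using Lc_nonneg
    by (intro mult_left_mono expectation_mean_sq_grad_delayed mean_sq_grad_growth) auto
  moreover have "expectation (\<lambda>\<omega>. inner (grad (x k \<omega>)) (?\<Delta> \<omega>))
      \<le> - (\<eta> / m) * (mean_sq_grad k * (1 - \<eta> * Lr / (2 * sqrt m) * (T + M\<^sub>\<rho> * N\<^sub>\<rho>)))"
  proof -
    have "measure_pmf.expectation q
        (\<lambda>t. mean_sq_grad k * (1 - \<eta> * Lr / (2 * sqrt m) * (real t + M\<^sub>\<rho> * (real t * \<rho> ^ t))))
      \<le> measure_pmf.expectation q (\<lambda>t. expectation (\<lambda>\<omega>. inner (grad (x k \<omega>)) (grad (x (k - t) \<omega>))))"
      by (intro integral_mono stale_inner_lower_bound Bochner_Integration.integrable_diff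
          Bochner_Integration.integrable_add integrable_mult_right int_t int_N
          integrable_delayed[of "\<lambda>l. expectation (\<lambda>\<omega>. inner (grad (x k \<omega>)) (grad (x l \<omega>)))" k]
          measure_pmf.integrable_const)
    moreover have "measure_pmf.expectation q
        (\<lambda>t. mean_sq_grad k * (1 - \<eta> * Lr / (2 * sqrt m) * (real t + M\<^sub>\<rho> * (real t * \<rho> ^ t))))
      = mean_sq_grad k * (1 - \<eta> * Lr / (2 * sqrt m) * (T + M\<^sub>\<rho> * N\<^sub>\<rho>))"
      using int_t int_N by (simp add: T N)
    ultimately show ?thesis
      unfolding expectation_step_inner using eta_pos
      by (intro mult_left_mono_neg) auto
  qed
  moreover have "- (\<eta> / m) * (mean_sq_grad k * (1 - \<eta> * Lr / (2 * sqrt m) * (T + M\<^sub>\<rho> * N\<^sub>\<rho>)))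
      + Lc / 2 * (\<eta>\<^sup>2 / m * (M\<^sub>\<rho> * mean_sq_grad k))
      = - (\<eta> / (2 * real m) * (2 - \<eta> * Lr / sqrt (real m) * (N\<^sub>\<rho> * M\<^sub>\<rho> + T) - \<eta> * Lc * M\<^sub>\<rho>) * mean_sq_grad k)"
  proof -
    have "- h * (A * (1 - u / 2 * (T + M\<^sub>\<rho> * N\<^sub>\<rho>))) + Lc / 2 * (h * \<eta> * (M\<^sub>\<rho> * A))
        = - (h / 2 * (2 - u * (N\<^sub>\<rho> * M\<^sub>\<rho> + T) - \<eta> * Lc * M\<^sub>\<rho>) * A)" for h u A :: real
      by (simp add: field_simps)
    from this[of "\<eta> / m" "mean_sq_grad k" "\<eta> * Lr / sqrt m"] show ?thesis
      by (simp add: power2_eq_square mult.commute)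
  qed
  ultimately show ?thesis using descent by linarith
qed

end

section \<open>Convergence rates\<close>

text \<open>
  The recursion gives \<open>e (k + 1) \<le> e k (1 - c e k) \<le> e k / (1 + c e k)\<close>, so the reciprocals of \<open>e\<close>
  grow by at least \<open>c\<close> in each step. If \<open>e 0 = 0\<close>, the convention \<open>inverse 0 = 0\<close> makes the
  right-hand side nonnegative rather than zero, which is enough.
\<close>

lemma sublinear_recursion:
  fixes e :: "nat \<Rightarrow> real"
  assumes step: "\<And>k. e (Suc k) \<le> e k - c * (e k)\<^sup>2" and nonneg: "\<And>k. 0 \<le> e k" and c: "0 \<le> c"
  shows "e k \<le> 1 / (inverse (e 0) + real k * c)"
proof (cases "e 0 = 0")
  case True
  have "e k \<le> e 0"
  proof (induction k)
    case (Suc k)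
    have "0 \<le> c * (e k)\<^sup>2" using c by simp
    with Suc step[of k] show ?case by linarith
  qed simp
  then show ?thesis using True c by (auto intro: order_trans)
next
  case False
  then have e0: "0 < e 0" using nonneg[of 0] by linarith
  show ?thesis
  proof (induction k)
    case (Suc k)
    define s where "s = inverse (e 0) + real k * c"
    have s: "0 < s" using e0 c by (simp add: s_def add_pos_nonneg)
    show ?case
    proof (cases "e k = 0")
      case True
      then show ?thesis using step[of k] e0 c by (auto intro: order_trans)
    next
      case False
      define u where "u = e k"
      have u: "0 < u" "u \<le> 1 / s" using False nonneg[of k] Suc by (auto simp: u_def s_def)
      have "e (Suc k) * (1 + c * u) \<le> u * (1 - c * u) * (1 + c * u)"
        using step[of k] u(1) c by (intro mult_right_mono) (auto simp: u_def algebra_simps power2_eq_square)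
      also have "\<dots> = u - u * (c * u)\<^sup>2" by (simp add: algebra_simps power2_eq_square)
      also have "\<dots> \<le> u" using u(1) by simp
      finally have "e (Suc k) \<le> u / (1 + c * u)"
        using u(1) c by (simp add: pos_le_divide_eq add_pos_nonneg)
      also have "\<dots> = 1 / (1 / u + c)" using u(1) by (simp add: field_simps)
      also have "\<dots> \<le> 1 / (s + c)"
        using u s c by (intro divide_left_mono mult_pos_pos add_mono add_pos_nonneg)
          (auto simp: field_simps)
      finally show ?thesis by (simp add: s_def algebra_simps)
    qed
  qed (simp add: inverse_eq_divide)
qed

text \<open>
  A geometric factor absorbs the linear one: \<open>t (\<rho> / \<sigma>)\<^sup>t\<close> tends to zero and is therefore bounded.
\<close>

lemma integrable_powers_below:
  fixes q :: "nat pmf" and \<sigma> \<rho> :: real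
  assumes int: "integrable (measure_pmf q) (\<lambda>t. \<sigma> ^ t)" and rho: "1 < \<rho>" "\<rho> < \<sigma>"
  shows "integrable (measure_pmf q) (\<lambda>t. \<rho> ^ t)"
    and "integrable (measure_pmf q) (\<lambda>t. real t * \<rho> ^ t)"
    and "integrable (measure_pmf q) (\<lambda>t. real t)"
proof -
  have "(\<lambda>t. real t * (\<rho> / \<sigma>) ^ t) \<longlonglongrightarrow> 0"
    using rho by (intro powser_times_n_limit_0) auto
  then obtain C where C: "\<And>t. \<bar>real t * (\<rho> / \<sigma>) ^ t\<bar> \<le> C"
    by (elim convergentI[THEN convergent_imp_Bseq, THEN BseqE]) auto
  have bound: "real t * \<rho> ^ t \<le> C * \<sigma> ^ t" for t
  proof -
    have "real t * \<rho> ^ t = real t * (\<rho> / \<sigma>) ^ t * \<sigma> ^ t"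
      using rho by (simp add: power_divide)
    also have "\<dots> \<le> C * \<sigma> ^ t"
      using C[of t] rho by (intro mult_right_mono) auto
    finally show ?thesis .
  qed
  have dominated: "integrable (measure_pmf q) g"
    if "integrable (measure_pmf q) h" "\<And>t. 0 \<le> g t" "\<And>t. g t \<le> h t" for g h :: "nat \<Rightarrow> real"
  proof (rule Bochner_Integration.integrable_bound[OF that(1)])
    have "norm (g t) \<le> norm (h t)" for t
      using that(2,3)[of t] by simp
    then show "AE t in measure_pmf q. norm (g t) \<le> norm (h t)" by simp
  qed simp
  show "integrable (measure_pmf q) (\<lambda>t. \<rho> ^ t)"
    by (rule dominated[OF int]) (use rho in \<open>auto intro: power_mono\<close>)
  show N: "integrable (measure_pmf q) (\<lambda>t. real t * \<rho> ^ t)"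
    by (rule dominated[OF integrable_mult_right[OF int, of C]]) (use rho bound in auto)
  have "real t * 1 \<le> real t * \<rho> ^ t" for t
    using rho by (intro mult_left_mono one_le_power) auto
  then show "integrable (measure_pmf q) (\<lambda>t. real t)"
    by (intro dominated[OF N]) auto
qed

theorem theorem4:
  fixes f :: "real ^ 'n \<Rightarrow> real"
    and grad :: "real ^ 'n \<Rightarrow> real ^ 'n"
    and b :: "'n \<Rightarrow> nat"
    and m :: nat
    and Lf Lr Lc :: real
    and q :: "nat pmf"
    and \<sigma> \<rho> \<eta> M\<^sub>\<rho> N\<^sub>\<rho> T \<kappa> D fstar :: real
    and M :: "'w measure"
    and i j :: "nat \<Rightarrow> 'w \<Rightarrow> nat"
    and x0 :: "real ^ 'n"
    and x :: "nat \<Rightarrow> 'w \<Rightarrow> real ^ 'n"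
  assumes blocks: "range b = {1..m}"
    and gradient: "\<And>y. GDERIV f y :> grad y"
    and bounded_below: "bdd_below (range f)"
    and minimizers_nonempty: "minimizers f \<noteq> {}"
    and fstar: "fstar = (INF y. f y)"
    and Lf: "\<And>y z. norm (grad y - grad z) \<le> Lf * norm (y - z)"
    and Lr: "\<And>y z l. l \<in> {1..m} \<Longrightarrow>
               norm (grad y - grad (y + block_embed b l z)) \<le> Lr * norm (block_embed b l z)"
    and Lc: "\<And>y z l. l \<in> {1..m} \<Longrightarrow>
               norm (block_embed b l (grad y) - block_embed b l (grad (y + block_embed b l z)))
                 \<le> Lc * norm (block_embed b l z)"
    and sigma: "\<sigma> > 1" "integrable (measure_pmf q) (\<lambda>t. \<sigma> ^ t)"
    and rho: "1 < \<rho>" "\<rho> < \<sigma>"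
    and M_rho: "M\<^sub>\<rho> = measure_pmf.expectation q (\<lambda>t. \<rho> ^ t)"
    and N_rho: "N\<^sub>\<rho> = measure_pmf.expectation q (\<lambda>t. real t * \<rho> ^ t)"
    and T: "T = measure_pmf.expectation q (\<lambda>t. real t)"
    and kappa: "\<kappa> = Lr / Lc"
    and eta1: "0 < \<eta>" "\<eta> \<le> (\<rho> - 1) * sqrt (real m) / (\<rho> * Lr * (1 + M\<^sub>\<rho>))"
    and eta2: "\<eta> < 2 * inverse (Lc * (M\<^sub>\<rho> + \<kappa> * (2 * N\<^sub>\<rho> * M\<^sub>\<rho> + T) / sqrt (real m)))"
    and D: "D = \<eta> / (2 * real m) *
                (2 - \<eta> * Lr / sqrt (real m) * (2 * N\<^sub>\<rho> * M\<^sub>\<rho> + T) - \<eta> * Lc * M\<^sub>\<rho>)"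
    and prob_space: "prob_space M"
    and sampling: "prob_space.async_sampling M m q i j"
    and iterates: "async_iterates b grad \<eta> x0 i j (space M) x"
  shows "(\<forall>B. convex_on UNIV f \<and>
              (\<forall>k. AE \<omega> in M. norm (x k \<omega> - closest_point (minimizers f) (x k \<omega>)) \<le> B) \<longrightarrow>
              (\<forall>k. prob_space.expectation M (\<lambda>\<omega>. f (x (k + 1) \<omega>) - fstar)
                   \<le> 1 / (inverse (f x0 - fstar) + (real k + 1) * D * inverse (B\<^sup>2)))) \<and>
         (\<forall>\<mu>. strongly_convex \<mu> f \<longrightarrow>
              (\<forall>k. prob_space.expectation M (\<lambda>\<omega>. f (x (k + 1) \<omega>) - fstar)
                   \<le> (1 - 2 * \<mu> * D) * prob_space.expectation M (\<lambda>\<omega>. f (x k \<omega>) - fstar)))"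
proof -
  interpret prob_space M by (rule prob_space)
  have M_nonneg: "0 \<le> M\<^sub>\<rho>" and N_nonneg: "0 \<le> N\<^sub>\<rho>"
    using rho by (auto simp: M_rho N_rho intro!: integral_nonneg_AE)
  \<comment> \<open>Division by zero yields zero, so each upper bound on \<open>\<eta> > 0\<close> has a positive denominator.\<close>
  have Lr_pos: "0 < Lr"
  proof (rule ccontr)
    assume "\<not> 0 < Lr"
    then have "\<rho> * Lr * (1 + M\<^sub>\<rho>) \<le> 0"
      using rho M_nonneg by (simp add: mult_nonneg_nonpos mult_nonpos_nonneg)
    then have "(\<rho> - 1) * sqrt (real m) / (\<rho> * Lr * (1 + M\<^sub>\<rho>)) \<le> 0"
      using rho by (intro divide_nonneg_nonpos) auto
    then show False using eta1 by linarith
  qed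
  have Lc_pos: "0 < Lc"
  proof -
    \<comment> \<open>Blocks are nonempty, so some block vector has positive norm and \<open>Lc\<close> cannot be negative.\<close>
    let ?l = "b undefined" and ?z = "(\<chi> _. 1) :: real ^ 'n"
    have "block_embed b ?l ?z $ undefined \<noteq> 0 $ undefined" by simp
    then have "0 < norm (block_embed b ?l ?z)" by (metis zero_less_norm_iff)
    moreover have "0 \<le> Lc * norm (block_embed b ?l ?z)"
      using Lc[of ?l 0 ?z] blocks by (metis norm_ge_zero order_trans rangeI)
    ultimately have "0 \<le> Lc" by (simp add: zero_le_mult_iff)
    moreover have "Lc \<noteq> 0" using eta1(1) eta2 by auto
    ultimately show ?thesis by simp
  qed
  interpret stable_async_block_descent M b grad m q i j \<eta> x0 x Lr \<rho> M\<^sub>\<rho>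
    by unfold_locales
       (use blocks sampling iterates Lr Lr_pos rho integrable_powers_below[OF sigma(2) rho] M_rho eta1 in auto)
  define S where "S = Lc * (M\<^sub>\<rho> + \<kappa> * (2 * N\<^sub>\<rho> * M\<^sub>\<rho> + T) / sqrt (real m))"
  have S: "S = Lc * M\<^sub>\<rho> + Lr * (2 * N\<^sub>\<rho> * M\<^sub>\<rho> + T) / sqrt (real m)"
    using Lc_pos by (simp add: S_def kappa distrib_left)
  have "\<eta> * S \<le> 2"
  proof (cases "0 < S")
    case True
    then show ?thesis using eta2 unfolding S_def[symmetric] by (simp add: field_simps)
  next
    case False
    then show ?thesis using eta1(1) by (smt (verit) mult_nonneg_nonneg mult_minus_right)
  qed
  then have D_nonneg: "0 \<le> D"
    unfolding D using eta1(1) by (intro mult_nonneg_nonneg) (auto simp: S algebra_simps add_divide_distrib)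
  have grad_descent: "expectation (\<lambda>\<omega>. f (x (Suc k) \<omega>)) \<le> expectation (\<lambda>\<omega>. f (x k \<omega>)) - D * mean_sq_grad k" for k
  proof -
    \<comment> \<open>\<open>D\<close> subtracts twice the nonnegative \<open>N\<^sub>\<rho> M\<^sub>\<rho>\<close> term of \<open>expected_descent\<close>.\<close>
    have "D \<le> \<eta> / (2 * real m) * (2 - \<eta> * Lr / sqrt (real m) * (N\<^sub>\<rho> * M\<^sub>\<rho> + T) - \<eta> * Lc * M\<^sub>\<rho>)"
      unfolding D using eta1(1) Lr_pos M_nonneg N_nonneg
      by (intro mult_left_mono diff_right_mono diff_left_mono add_right_mono mult_right_mono) auto
    then have "D * mean_sq_grad k \<le> \<eta> / (2 * real m) *
        (2 - \<eta> * Lr / sqrt (real m) * (N\<^sub>\<rho> * M\<^sub>\<rho> + T) - \<eta> * Lc * M\<^sub>\<rho>) * mean_sq_grad k"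
      by (intro mult_right_mono mean_sq_grad_nonneg)
    moreover note expected_descent[OF gradient Lc order_less_imp_le[OF Lc_pos]
        integrable_powers_below(3,2)[OF sigma(2) rho] T N_rho, of k]
    ultimately show ?thesis by linarith
  qed
  obtain z where z: "z \<in> minimizers f" using minimizers_nonempty by blast
  have fstar_le: "fstar \<le> f y" for y
    unfolding fstar by (rule cINF_lower[OF bounded_below]) simp
  have minimizers_eq: "minimizers f = {y. f y \<le> fstar}"
  proof -
    have "y \<in> minimizers f \<longleftrightarrow> (\<forall>w. f y \<le> f w)" for y
      by (auto simp: minimizers_def is_arg_min_def not_less)
    moreover have "f y \<le> fstar \<longleftrightarrow> (\<forall>w. f y \<le> f w)" for y
      using fstar_le unfolding fstar by (auto intro: cINF_greatest order_trans)
    ultimately show ?thesis by blast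
  qed
  have at_minimizer: "f y = fstar" if "y \<in> minimizers f" for y
    using that fstar_le[of y] by (simp add: minimizers_eq)
  define e where "e k = expectation (\<lambda>\<omega>. f (x k \<omega>) - fstar)" for k
  have int_gap: "integrable M (\<lambda>\<omega>. f (x k \<omega>) - fstar)" for k
    by (rule integrable_iterate)
  have e_eq: "e k = expectation (\<lambda>\<omega>. f (x k \<omega>)) - fstar" for k
    by (simp add: e_def integrable_iterate prob_space)
  have e_step: "e (Suc k) \<le> e k - D * mean_sq_grad k" for k
    using grad_descent[of k] by (simp add: e_eq)
  have e_nonneg: "0 \<le> e k" for k
    unfolding e_def using fstar_le by (intro integral_nonneg_AE) auto
  have e_0: "e 0 = f x0 - fstar"
  proof -
    have "e 0 = expectation (\<lambda>_. f x0 - fstar)"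
      unfolding e_def by (intro Bochner_Integration.integral_cong) (auto simp: iterate_0)
    then show ?thesis by (simp add: prob_space)
  qed
  have convex_case: "e (Suc k) \<le> 1 / (inverse (f x0 - fstar) + (real k + 1) * D * inverse (B\<^sup>2))"
    if conv: "convex_on UNIV f"
      and near: "\<And>k. AE \<omega> in M. norm (x k \<omega> - closest_point (minimizers f) (x k \<omega>)) \<le> B" for B k
  proof -
    have "continuous_on UNIV f"
      using gradient unfolding gderiv_def
      by (intro continuous_at_imp_continuous_on ballI has_derivative_continuous) blast
    then have "closed (minimizers f)"
      unfolding minimizers_eq by (intro closed_Collect_le continuous_on_const)
    then have proj: "closest_point (minimizers f) y \<in> minimizers f" for y
      using minimizers_nonempty by (rule closest_point_in_set)
    have gap_sq: "(e k)\<^sup>2 \<le> B\<^sup>2 * mean_sq_grad k" for k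
    proof -
      have int_gap_sq: "integrable M (\<lambda>\<omega>. (f (x k \<omega>) - fstar)\<^sup>2)"
        by (rule integrable_iterate)
      have "0 \<le> expectation (\<lambda>\<omega>. (f (x k \<omega>) - fstar)\<^sup>2) - (e k)\<^sup>2"
        unfolding e_def variance_eq[OF int_gap int_gap_sq, symmetric] by (rule variance_positive)
      also have "expectation (\<lambda>\<omega>. (f (x k \<omega>) - fstar)\<^sup>2)
          \<le> expectation (\<lambda>\<omega>. B\<^sup>2 * (norm (grad (x k \<omega>)))\<^sup>2)"
      proof (intro integral_mono_AE int_gap_sq integrable_mult_right integrable_iterate)
        show "AE \<omega> in M. (f (x k \<omega>) - fstar)\<^sup>2 \<le> B\<^sup>2 * (norm (grad (x k \<omega>)))\<^sup>2"
          using near[of k]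
        proof eventually_elim
          case (elim \<omega>)
          let ?y = "x k \<omega>"
          have "f ?y - fstar \<le> norm (grad ?y) * norm (?y - closest_point (minimizers f) ?y)"
            using convex_gap_bound[OF gradient conv, of ?y "closest_point (minimizers f) ?y"]
            by (simp add: at_minimizer[OF proj])
          also have "\<dots> \<le> norm (grad ?y) * B"
            using elim by (intro mult_left_mono) auto
          finally have "(f ?y - fstar)\<^sup>2 \<le> (norm (grad ?y) * B)\<^sup>2"
            using fstar_le[of ?y] by (intro power_mono) auto
          then show ?case by (simp add: power_mult_distrib mult.commute)
        qed
      qed
      finally show ?thesis by (simp add: mean_sq_grad_def)
    qed
    have "D * inverse (B\<^sup>2) * (e k)\<^sup>2 \<le> D * mean_sq_grad k" for k
    proof -
      have "inverse (B\<^sup>2) * (e k)\<^sup>2 \<le> inverse (B\<^sup>2) * (B\<^sup>2 * mean_sq_grad k)"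
        by (intro mult_left_mono gap_sq) auto
      (* Equality unless B = 0, where inverse (B^2) = 0 and the left-hand side vanishes. *)
      also have "\<dots> \<le> mean_sq_grad k" using mean_sq_grad_nonneg[of k] by (cases "B = 0") (auto simp: field_simps)
      finally show ?thesis using D_nonneg by (simp add: mult.assoc mult_left_mono)
    qed
    then have "e (Suc n) \<le> e n - D * inverse (B\<^sup>2) * (e n)\<^sup>2" for n
      using e_step[of n] by (meson diff_left_mono order_trans)
    then have "e (Suc k) \<le> 1 / (inverse (e 0) + real (Suc k) * (D * inverse (B\<^sup>2)))"
      using D_nonneg by (intro sublinear_recursion e_nonneg) auto
    then show ?thesis by (simp add: e_0 add.commute mult.assoc)
  qed
  have strongly_convex_case: "e (Suc k) \<le> (1 - 2 * \<mu> * D) * e k" if sc: "strongly_convex \<mu> f" for \<mu> k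
  proof -
    have "expectation (\<lambda>\<omega>. 2 * \<mu> * (f (x k \<omega>) - fstar)) \<le> expectation (\<lambda>\<omega>. (norm (grad (x k \<omega>)))\<^sup>2)"
      using polyak_lojasiewicz[OF gradient sc, of _ z]
      by (intro integral_mono integrable_iterate) (auto simp: at_minimizer[OF z])
    then have "2 * \<mu> * e k \<le> mean_sq_grad k"
      by (simp add: e_def mean_sq_grad_def)
    then have "D * (2 * \<mu> * e k) \<le> D * mean_sq_grad k"
      using D_nonneg by (rule mult_left_mono)
    then show ?thesis using e_step[of k] by (simp add: algebra_simps)
  qed
  show ?thesis
    using convex_case strongly_convex_case by (simp add: e_def)
qed

end
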